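(* Let $\mathbb{X}=\langle X,\{\rho_i:i\in I\}\rangle$ be an indivisible relational structure. Then: (a) the separative modification of $\langle\mathbb{P}(\mathbb{X}),\subseteq\rangle$ is $\langle\mathbb{P}(\mathbb{X}),\subseteq_{\mathcal{I}_{\mathbb{X}}}\rangle$, where $A\subseteq_{\mathcal{I}_{\mathbb{X}}}B$ iff $A\setminus B\in\mathcal{I}_{\mathbb{X}}$; (b) the separative quotient $\mathrm{sq}\langle\mathbb{P}(\mathbb{X}),\subseteq\rangle$ is isomorphic to a dense subset of $\langle (P(X)/{=_{\mathcal{I}_{\mathbb{X}}}})^+,\le_{\mathcal{I}_{\mathbb{X}}}\rangle$; hence $\langle\mathbb{P}(\mathbb{X}),\subseteq\rangle$ is forcing equivalent to $(P(X)/\mathcal{I}_{\mathbb{X}})^+$.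
   Context: $\mathbb{X}$ is indivisible iff for every partition $X=A\cup B$ the structure $\mathbb{X}$ embeds into the substructure on $A$ or into the substructure on $B$. $\mathbb{P}(\mathbb{X})$ is the set of all $A\subseteq X$ whose induced substructure is isomorphic to $\mathbb{X}$; $\mathcal{I}_{\mathbb{X}}=\{I\subseteq X:\neg\exists A\in\mathbb{P}(\mathbb{X})\ A\subseteq I\}$ (an ideal when $\mathbb{X}$ is indivisible). For an ideal $\mathcal{I}$: $A=_{\mathcal{I}}B$ iff $A\triangle B\in\mathcal{I}$; $(P(X)/{=_{\mathcal{I}}})^+$ is the set of classes $[A]$ with $A\notin\mathcal{I}$, ordered by $[A]\le_{\mathcal{I}}[B]$ iff $A\setminus B\in\mathcal{I}$. For a poset $\langle P,\le\rangle$, the separative modification is $\langle P,\le^*\rangle$ with $p\le^* q$ iff $\forall r\le p\ \exists s\le r\ s\le q$, and the separative quotient is $P/{=^*}$ (where $p=^*q$ iff $p\le^*q\wedge q\le^*p$) ordered by $[p]\trianglelefteq[q]$ iff $p\le^*q$. *)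

theory Defs
  imports Main "HOL-Analysis.Abstract_Topology"
begin

section \<open>Relational structures\<close>

definition tuples :: "'a set \<Rightarrow> nat \<Rightarrow> 'a list set" where
  "tuples U n = {xs. length xs = n \<and> set xs \<subseteq> U}"

record ('a, 'i) rel_struct =
  univ :: "'a set"
  idx :: "'i set"
  arity :: "'i \<Rightarrow> nat"
  rels :: "'i \<Rightarrow> 'a list set"

definition relational_structure :: "('a, 'i) rel_struct \<Rightarrow> bool" where
  "relational_structure X \<longleftrightarrow>
     univ X \<noteq> {} \<and> (\<forall>i\<in>idx X. rels X i \<subseteq> tuples (univ X) (arity X i))"

definition substructure :: "('a, 'i) rel_struct \<Rightarrow> 'a set \<Rightarrow> ('a, 'i) rel_struct" where
  "substructure X A =
     \<lparr>univ = A, idx = idx X, arity = arity X, rels = (\<lambda>i. rels X i \<inter> tuples A (arity X i))\<rparr>"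

definition embedding :: "('a, 'i) rel_struct \<Rightarrow> ('b, 'i) rel_struct \<Rightarrow> ('a \<Rightarrow> 'b) \<Rightarrow> bool" where
  "embedding X Y f \<longleftrightarrow>
     idx X = idx Y \<and> (\<forall>i\<in>idx X. arity X i = arity Y i) \<and>
     f ` univ X \<subseteq> univ Y \<and> inj_on f (univ X) \<and>
     (\<forall>i\<in>idx X. \<forall>xs\<in>tuples (univ X) (arity X i). xs \<in> rels X i \<longleftrightarrow> map f xs \<in> rels Y i)"

definition embeds :: "('a, 'i) rel_struct \<Rightarrow> ('b, 'i) rel_struct \<Rightarrow> bool" where
  "embeds X Y \<longleftrightarrow> (\<exists>f. embedding X Y f)"

definition isomorphic_structures :: "('a, 'i) rel_struct \<Rightarrow> ('b, 'i) rel_struct \<Rightarrow> bool" where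
  "isomorphic_structures X Y \<longleftrightarrow> (\<exists>f. embedding X Y f \<and> f ` univ X = univ Y)"

definition indivisible :: "('a, 'i) rel_struct \<Rightarrow> bool" where
  "indivisible X \<longleftrightarrow>
     (\<forall>A B. univ X = A \<union> B \<and> A \<inter> B = {} \<longrightarrow>
        embeds X (substructure X A) \<or> embeds X (substructure X B))"

definition copies :: "('a, 'i) rel_struct \<Rightarrow> 'a set set" where
  "copies X = {A. A \<subseteq> univ X \<and> isomorphic_structures (substructure X A) X}"

definition copy_ideal :: "('a, 'i) rel_struct \<Rightarrow> 'a set set" where
  "copy_ideal X = {J. J \<subseteq> univ X \<and> \<not> (\<exists>A\<in>copies X. A \<subseteq> J)}"

section \<open>Preorders\<close>

text \<open>A preorder is given by its carrier \<open>P\<close> and its relation \<open>R\<close>, with \<open>(p, q) \<in> R\<close> meaning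
  that \<open>p\<close> is below (stronger than) \<open>q\<close>.\<close>

definition order_iso ::
  "'a set \<Rightarrow> 'a rel \<Rightarrow> 'b set \<Rightarrow> 'b rel \<Rightarrow> ('a \<Rightarrow> 'b) \<Rightarrow> bool" where
  "order_iso P R Q S f \<longleftrightarrow>
     bij_betw f P Q \<and> (\<forall>x\<in>P. \<forall>y\<in>P. (x, y) \<in> R \<longleftrightarrow> (f x, f y) \<in> S)"

definition order_isomorphic :: "'a set \<Rightarrow> 'a rel \<Rightarrow> 'b set \<Rightarrow> 'b rel \<Rightarrow> bool" where
  "order_isomorphic P R Q S \<longleftrightarrow> (\<exists>f. order_iso P R Q S f)"

definition dense_subset :: "'a set \<Rightarrow> 'a rel \<Rightarrow> 'a set \<Rightarrow> bool" where
  "dense_subset P R D \<longleftrightarrow> D \<subseteq> P \<and> (\<forall>p\<in>P. \<exists>d\<in>D. (d, p) \<in> R)"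

definition separative_modification :: "'a set \<Rightarrow> 'a rel \<Rightarrow> 'a rel" where
  "separative_modification P R =
     {(p, q) \<in> P \<times> P. \<forall>r\<in>P. (r, p) \<in> R \<longrightarrow> (\<exists>s\<in>P. (s, r) \<in> R \<and> (s, q) \<in> R)}"

definition separative_equiv :: "'a set \<Rightarrow> 'a rel \<Rightarrow> 'a rel" where
  "separative_equiv P R =
     {(p, q). (p, q) \<in> separative_modification P R \<and> (q, p) \<in> separative_modification P R}"

definition sq_carrier :: "'a set \<Rightarrow> 'a rel \<Rightarrow> 'a set set" where
  "sq_carrier P R = P // separative_equiv P R"

definition sq_le :: "'a set \<Rightarrow> 'a rel \<Rightarrow> 'a set rel" where
  "sq_le P R =
     {(separative_equiv P R `` {p}, separative_equiv P R `` {q}) | p q.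
        (p, q) \<in> separative_modification P R}"

section \<open>Positive part of a power set modulo an ideal\<close>

definition mod_equiv :: "'a set \<Rightarrow> 'a set set \<Rightarrow> 'a set rel" where
  "mod_equiv U J = {(A, B). A \<subseteq> U \<and> B \<subseteq> U \<and> sym_diff A B \<in> J}"

definition quot_pos_carrier :: "'a set \<Rightarrow> 'a set set \<Rightarrow> 'a set set set" where
  "quot_pos_carrier U J = {mod_equiv U J `` {A} | A. A \<subseteq> U \<and> A \<notin> J}"

definition quot_pos_le :: "'a set \<Rightarrow> 'a set set \<Rightarrow> 'a set set rel" where
  "quot_pos_le U J =
     {(mod_equiv U J `` {A}, mod_equiv U J `` {B}) | A B.
        A \<subseteq> U \<and> A \<notin> J \<and> B \<subseteq> U \<and> B \<notin> J \<and> A - B \<in> J}"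

section \<open>Forcing equivalence\<close>

text \<open>The Boolean completion of a preorder is the complete Boolean algebra, ordered by inclusion,
  of the regular open sets of the topology whose open sets are the downward closed ones. Two
  preorders are forcing equivalent if their Boolean completions are isomorphic; an order
  isomorphism of Boolean algebras is automatically an isomorphism of complete Boolean algebras.\<close>

definition down_topology :: "'a set \<Rightarrow> 'a rel \<Rightarrow> 'a topology" where
  "down_topology P R =
     topology (\<lambda>U. U \<subseteq> P \<and> (\<forall>p\<in>U. \<forall>q\<in>P. (q, p) \<in> R \<longrightarrow> q \<in> U))"

lemma openin_down_topology:
  "openin (down_topology P R) U \<longleftrightarrow>
     U \<subseteq> P \<and> (\<forall>p\<in>U. \<forall>q\<in>P. (q, p) \<in> R \<longrightarrow> q \<in> U)"
proof -
  have "istopology (\<lambda>U. U \<subseteq> P \<and> (\<forall>p\<in>U. \<forall>q\<in>P. (q, p) \<in> R \<longrightarrow> q \<in> U))"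
    unfolding istopology_def by blast
  then show ?thesis
    by (simp add: down_topology_def)
qed

definition regular_open_sets :: "'a topology \<Rightarrow> 'a set set" where
  "regular_open_sets T = {U. T interior_of (T closure_of U) = U}"

definition boolean_completion :: "'a set \<Rightarrow> 'a rel \<Rightarrow> 'a set set" where
  "boolean_completion P R = regular_open_sets (down_topology P R)"

definition forcing_equivalent :: "'a set \<Rightarrow> 'a rel \<Rightarrow> 'b set \<Rightarrow> 'b rel \<Rightarrow> bool" where
  "forcing_equivalent P R Q S \<longleftrightarrow>
     order_isomorphic
       (boolean_completion P R) (relation_of (\<subseteq>) (boolean_completion P R))
       (boolean_completion Q S) (relation_of (\<subseteq>) (boolean_completion Q S))"

end

theory Submission
  imports Defs
begin

text \<open>
  By indivisibility, a copy covered by two sets contains a copy inside one of them, so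
  \<open>copy_ideal X\<close> is an ideal whose positive sets are exactly the sets containing a copy. Everything
  then follows from this description of the ideal: if \<open>A - B\<close> is small, a copy below \<open>A\<close> stays
  positive after intersection with \<open>B\<close>; if not, a copy inside \<open>A - B\<close> is incompatible with \<open>B\<close>.
  So \<open>A \<mapsto> [A]\<close> is a dense map reflecting the separative order, and preimage under such a map is
  an isomorphism of the regular open algebras.
\<close>

section \<open>Boolean completions and dense maps\<close>

text \<open>The least open set around \<open>p\<close> is the cone of elements below
  \<open>p\<close>: reflexivity puts \<open>p\<close> into it and transitivity makes it open.
  Closure and interior are thus read off cones, and regularity says that \<open>U\<close> contains
  every \<open>p\<close> below which it is dense.\<close>

lemma boolean_completion_iff:
  assumes "refl_on P R" "trans R"
  shows "U \<in> boolean_completion P R \<longleftrightarrow>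
    U \<subseteq> P \<and> (\<forall>p\<in>U. \<forall>r\<in>P. (r, p) \<in> R \<longrightarrow> r \<in> U) \<and>
    (\<forall>p\<in>P. (\<forall>r\<in>P. (r, p) \<in> R \<longrightarrow> (\<exists>s\<in>U. (s, r) \<in> R)) \<longrightarrow> p \<in> U)"
    (is "_ \<longleftrightarrow> ?reg")
proof -
  let ?T = "down_topology P R"
  have below: "openin ?T {r\<in>P. (r, p) \<in> R}" for p
    using assms(2) unfolding openin_down_topology by (auto dest: transD)
  have refl: "(p, p) \<in> R" if "p \<in> P" for p
    using assms(1) that by (rule refl_onD)
  have "openin ?T P"
    unfolding openin_down_topology by blast
  then have top: "topspace ?T = P"
    using openin_down_topology[of P R "topspace ?T"] openin_subset by blast
  \<comment> \<open>\<open>U\<close> is an arbitrary set here, hence the intersection with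
    \<open>P\<close>.\<close>
  have cl: "?T closure_of U = {p\<in>P. \<exists>s\<in>U \<inter> P. (s, p) \<in> R}" for U
  proof (intro equalityI subsetI)
    fix p assume "p \<in> ?T closure_of U"
    then have p: "p \<in> P" and meet: "\<And>T. p \<in> T \<Longrightarrow> openin ?T T \<Longrightarrow> \<exists>s. s \<in> U \<and> s \<in> T"
      unfolding in_closure_of top by auto
    have "\<exists>s. s \<in> U \<and> s \<in> {r\<in>P. (r, p) \<in> R}"
      using p refl by (intro meet below) simp
    with p show "p \<in> {p\<in>P. \<exists>s\<in>U \<inter> P. (s, p) \<in> R}" by blast
  next
    fix p assume "p \<in> {p\<in>P. \<exists>s\<in>U \<inter> P. (s, p) \<in> R}"
    then show "p \<in> ?T closure_of U"
      unfolding in_closure_of top openin_down_topology by blast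
  qed
  have int: "?T interior_of S = {p\<in>P. \<forall>r\<in>P. (r, p) \<in> R \<longrightarrow> r \<in> S}" for S
  proof (intro equalityI subsetI)
    fix p assume "p \<in> ?T interior_of S"
    then show "p \<in> {p\<in>P. \<forall>r\<in>P. (r, p) \<in> R \<longrightarrow> r \<in> S}"
      unfolding interior_of_def openin_down_topology by blast
  next
    fix p assume p: "p \<in> {p\<in>P. \<forall>r\<in>P. (r, p) \<in> R \<longrightarrow> r \<in> S}"
    then have "p \<in> {r\<in>P. (r, p) \<in> R}" "{r\<in>P. (r, p) \<in> R} \<subseteq> S"
      using refl by auto
    then show "p \<in> ?T interior_of S"
      unfolding interior_of_def using below by blast
  qed
  have reg: "U \<in> boolean_completion P R \<longleftrightarrow>
      {p\<in>P. \<forall>r\<in>P. (r, p) \<in> R \<longrightarrow> (\<exists>s\<in>U \<inter> P. (s, r) \<in> R)} = U" (is "_ \<longleftrightarrow> ?V = U")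
    unfolding boolean_completion_def regular_open_sets_def cl int by auto
  \<comment> \<open>\<open>?V\<close> is downward closed for every \<open>U\<close>, so the fixed
    point equation alone makes \<open>U\<close> downward closed.\<close>
  have down: "r \<in> ?V" if "p \<in> ?V" "r \<in> P" "(r, p) \<in> R" for p r
    using that transD[OF assms(2)] by blast
  show ?thesis
  proof
    assume "U \<in> boolean_completion P R"
    then have V: "?V = U" unfolding reg .
    then have "U \<subseteq> P" by blast
    moreover have "r \<in> U" if "p \<in> U" "r \<in> P" "(r, p) \<in> R" for p r
      using down[of p r] that unfolding V by blast
    moreover have "p \<in> U" if "p \<in> P" "\<forall>r\<in>P. (r, p) \<in> R \<longrightarrow> (\<exists>s\<in>U. (s, r) \<in> R)" for p
    proof -
      have "p \<in> ?V" using that \<open>U \<subseteq> P\<close> by blast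
      then show ?thesis unfolding V .
    qed
    ultimately show "?reg" by blast
  next
    assume ?reg
    then have sub: "U \<subseteq> P" and down: "\<And>p r. p \<in> U \<Longrightarrow> r \<in> P \<Longrightarrow> (r, p) \<in> R \<Longrightarrow> r \<in> U"
      and dense: "\<And>p. p \<in> P \<Longrightarrow> \<forall>r\<in>P. (r, p) \<in> R \<longrightarrow> (\<exists>s\<in>U. (s, r) \<in> R) \<Longrightarrow> p \<in> U"
      by blast+
    have "?V \<subseteq> U" using dense by blast
    moreover have "U \<subseteq> ?V"
    proof
      fix p assume "p \<in> U"
      then show "p \<in> ?V" using sub down refl by blast
    qed
    ultimately show "U \<in> boolean_completion P R" unfolding reg by blast
  qed
qed

lemma order_isomorphic_sym:
  assumes "order_isomorphic P R Q S"
  shows "order_isomorphic Q S P R"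
proof -
  obtain f where f: "bij_betw f P Q" "\<forall>x\<in>P. \<forall>y\<in>P. (x, y) \<in> R \<longleftrightarrow> (f x, f y) \<in> S"
    using assms unfolding order_isomorphic_def order_iso_def by blast
  have "(x, y) \<in> S \<longleftrightarrow> (inv_into P f x, inv_into P f y) \<in> R" if "x \<in> Q" "y \<in> Q" for x y
    using f(2) that bij_betw_inv_into_right[OF f(1)]
      bij_betw_apply[OF bij_betw_inv_into[OF f(1)]] by metis
  then show ?thesis
    using bij_betw_inv_into[OF f(1)] unfolding order_isomorphic_def order_iso_def by blast
qed

text \<open>The map \<open>e\<close> may be far from injective. It suffices that it is monotone,
  that \<open>e p\<close> below \<open>e p'\<close> makes \<open>p\<close> and \<open>p'\<close>
  compatible, and that its range is dense: preimage under \<open>e\<close> is then an order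
  isomorphism between the algebras of regular open sets.\<close>

lemma forcing_equivalent_dense_map:
  assumes R: "refl_on P R" "trans R" and S: "refl_on Q S" "trans S"
    and e: "e ` P \<subseteq> Q"
    and le: "\<And>p p'. p \<in> P \<Longrightarrow> p' \<in> P \<Longrightarrow>
      (e p, e p') \<in> S \<longleftrightarrow> (p, p') \<in> separative_modification P R"
    and dense: "dense_subset Q S (e ` P)"
  shows "forcing_equivalent P R Q S"
proof -
  have dense': "\<exists>p\<in>P. (e p, q) \<in> S" if "q \<in> Q" for q
    using dense that unfolding dense_subset_def by blast
  have eQ: "e p \<in> Q" if "p \<in> P" for p
    using e that by blast
  \<comment> \<open>The case \<open>r = p\<close> of the separative order.\<close>
  have compat: "\<exists>s\<in>P. (s, p) \<in> R \<and> (s, p') \<in> R" if "p \<in> P" "p' \<in> P" "(e p, e p') \<in> S" for p p'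
    using le[OF that(1,2)] that(1,3) refl_onD[OF R(1)] unfolding separative_modification_def by blast
  \<comment> \<open>Transitivity puts \<open>R\<close> on \<open>P\<close> inside its separative
    modification, with the witness \<open>s = r\<close>.\<close>
  have mono: "(e p, e p') \<in> S" if "p \<in> P" "p' \<in> P" "(p, p') \<in> R" for p p'
    using that refl_onD[OF R(1)] transD[OF R(2)] le[OF that(1,2)]
    unfolding separative_modification_def by blast
  note tS = transD[OF S(2)]
    and rS = refl_onD[OF S(1)]
  have sub: "U \<subseteq> P" if "U \<in> boolean_completion P R" for U
    using that unfolding boolean_completion_iff[OF R] by blast
  have subQ: "V \<subseteq> Q" if "V \<in> boolean_completion Q S" for V
    using that unfolding boolean_completion_iff[OF S] by blast
  have regP: "p \<in> U"
    if "U \<in> boolean_completion P R" "p \<in> P"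
      "\<And>r. r \<in> P \<Longrightarrow> (r, p) \<in> R \<Longrightarrow> \<exists>s\<in>U. (s, r) \<in> R" for U p
    using that sub[OF that(1)] unfolding boolean_completion_iff[OF R] by blast
  have regQ: "q \<in> V"
    if "V \<in> boolean_completion Q S" "q \<in> Q"
      "\<And>r. r \<in> Q \<Longrightarrow> (r, q) \<in> S \<Longrightarrow> \<exists>s\<in>V. (s, r) \<in> S" for V q
    using that subQ[OF that(1)] unfolding boolean_completion_iff[OF S] by blast
  have downP: "r \<in> U"
    if "U \<in> boolean_completion P R" "p \<in> U" "r \<in> P" "(r, p) \<in> R" for U p r
    using that unfolding boolean_completion_iff[OF R] by blast
  have downQ: "r \<in> V"
    if "V \<in> boolean_completion Q S" "q \<in> V" "r \<in> Q" "(r, q) \<in> S" for V q r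
    using that unfolding boolean_completion_iff[OF S] by blast
  have regI_P: "U \<in> boolean_completion P R"
    if "U \<subseteq> P" "\<And>p r. p \<in> U \<Longrightarrow> r \<in> P \<Longrightarrow> (r, p) \<in> R \<Longrightarrow> r \<in> U"
      "\<And>p. p \<in> P \<Longrightarrow> \<forall>r\<in>P. (r, p) \<in> R \<longrightarrow> (\<exists>s\<in>U. (s, r) \<in> R) \<Longrightarrow> p \<in> U" for U
    unfolding boolean_completion_iff[OF R] using that by blast
  have regI_Q: "V \<in> boolean_completion Q S"
    if "V \<subseteq> Q" "\<And>q r. q \<in> V \<Longrightarrow> r \<in> Q \<Longrightarrow> (r, q) \<in> S \<Longrightarrow> r \<in> V"
      "\<And>q. q \<in> Q \<Longrightarrow> \<forall>r\<in>Q. (r, q) \<in> S \<longrightarrow> (\<exists>s\<in>V. (s, r) \<in> S) \<Longrightarrow> q \<in> V" for V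
    unfolding boolean_completion_iff[OF S] using that by blast
  let ?F = "\<lambda>V. {p\<in>P. e p \<in> V}"
  have F: "?F V \<in> boolean_completion P R" if V: "V \<in> boolean_completion Q S" for V
  proof (rule regI_P)
    fix p assume p: "p \<in> P" and H: "\<forall>r\<in>P. (r, p) \<in> R \<longrightarrow> (\<exists>s\<in>?F V. (s, r) \<in> R)"
    \<comment> \<open>By regularity, each \<open>q\<close> below \<open>e p\<close> needs an element
      of \<open>V\<close> below it. Density gives \<open>e p'\<close> below \<open>q\<close>,
      compatibility an \<open>s\<close> below \<open>p'\<close> and \<open>p\<close>, and
      \<open>H\<close> a \<open>t\<close> below \<open>s\<close> with \<open>e t\<close> in
      \<open>V\<close>.\<close>
    have "e p \<in> V"
    proof (rule regQ[OF V eQ[OF p]])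
      fix q assume q: "q \<in> Q" "(q, e p) \<in> S"
      obtain p' where p': "p' \<in> P" "(e p', q) \<in> S" using dense' q by blast
      obtain s where s: "s \<in> P" "(s, p') \<in> R" "(s, p) \<in> R"
        using compat p' p q tS by meson
      obtain t where t: "t \<in> P" "e t \<in> V" "(t, s) \<in> R" using H s by blast
      have "(e t, q) \<in> S" using mono t s p' tS by meson
      then show "\<exists>s\<in>V. (s, q) \<in> S" using t by blast
    qed
    then show "p \<in> ?F V" using p by blast
  qed (use downQ[OF V] mono eQ in blast)+
  \<comment> \<open>A regular open set is determined by the points \<open>e p\<close> in it, since
    by density such points lie below each of its elements. This gives both injectivity and
    reflection of inclusion.\<close>
  have reflect: "V \<subseteq> V'" if V: "V \<in> boolean_completion Q S" and V': "V' \<in> boolean_completion Q S"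
    and sub: "?F V \<subseteq> ?F V'" for V V'
  proof
    fix q assume q: "q \<in> V"
    show "q \<in> V'"
    proof (rule regQ[OF V'])
      show "q \<in> Q" using q subQ[OF V] by blast
      fix r assume r: "r \<in> Q" "(r, q) \<in> S"
      obtain p where p: "p \<in> P" "(e p, r) \<in> S" using dense' r by blast
      have "e p \<in> V" using downQ[OF V q eQ[OF p(1)]] p r tS by blast
      then show "\<exists>s\<in>V'. (s, r) \<in> S" using sub p by blast
    qed
  qed
  have surj: "\<exists>V\<in>boolean_completion Q S. ?F V = U" if U: "U \<in> boolean_completion P R" for U
  proof
    \<comment> \<open>Every set with preimage \<open>U\<close> that is downward closed in
      \<open>Q\<close> lies in this one.\<close>
    let ?V = "{q\<in>Q. \<forall>p\<in>P. (e p, q) \<in> S \<longrightarrow> p \<in> U}"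
    show "?V \<in> boolean_completion Q S"
    proof (rule regI_Q)
      fix q r assume "q \<in> ?V" "r \<in> Q" "(r, q) \<in> S"
      then show "r \<in> ?V" using tS by blast
    next
      fix q assume q: "q \<in> Q" and H: "\<forall>r\<in>Q. (r, q) \<in> S \<longrightarrow> (\<exists>s\<in>?V. (s, r) \<in> S)"
      \<comment> \<open>Below any \<open>r\<close> under \<open>p\<close>, move into
        \<open>?V\<close> at \<open>s\<close> and back into the range at \<open>e p'\<close>. Then
        \<open>p'\<close> is in \<open>U\<close> by the choice of \<open>?V\<close>, and it is
        compatible with \<open>r\<close>.\<close>
      have "p \<in> U" if p: "p \<in> P" "(e p, q) \<in> S" for p
      proof (rule regP[OF U p(1)])
        fix r assume r: "r \<in> P" "(r, p) \<in> R"
        then have "(e r, q) \<in> S" using mono p tS by blast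
        then obtain s where s: "s \<in> ?V" "(s, e r) \<in> S" using H eQ r by blast
        then obtain p' where p': "p' \<in> P" "(e p', s) \<in> S" using dense' by blast
        then have "p' \<in> U" using s by blast
        obtain t where "t \<in> P" "(t, p') \<in> R" "(t, r) \<in> R"
          using compat p' r s tS by meson
        then show "\<exists>s\<in>U. (s, r) \<in> R" using downP[OF U \<open>p' \<in> U\<close>] by blast
      qed
      then show "q \<in> ?V" using q by blast
    qed blast
    show "?F ?V = U"
    proof (intro equalityI subsetI)
      fix p assume "p \<in> ?F ?V"
      then show "p \<in> U" using rS eQ by blast
    next
      fix p assume p: "p \<in> U"
      then have pP: "p \<in> P" using sub[OF U] by blast
      \<comment> \<open>Every \<open>r\<close> below \<open>p'\<close> is compatible with
        \<open>p\<close>, so \<open>U\<close> is dense below \<open>p'\<close>.\<close>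
      have "p' \<in> U" if p': "p' \<in> P" "(e p', e p) \<in> S" for p'
      proof (rule regP[OF U p'(1)])
        fix r assume r: "r \<in> P" "(r, p') \<in> R"
        then have "(e r, e p) \<in> S" using mono p' tS by blast
        then show "\<exists>s\<in>U. (s, r) \<in> R" using compat[OF r(1) pP] downP[OF U p] by blast
      qed
      then show "p \<in> ?F ?V" using pP eQ by blast
    qed
  qed
  have "bij_betw ?F (boolean_completion Q S) (boolean_completion P R)"
    unfolding bij_betw_def
  proof
    show "inj_on ?F (boolean_completion Q S)"
      by (rule inj_onI) (use reflect in \<open>metis (no_types, lifting) subset_antisym order_refl\<close>)
    show "?F ` boolean_completion Q S = boolean_completion P R"
      using F surj by blast
  qed
  moreover have "(V, V') \<in> relation_of (\<subseteq>) (boolean_completion Q S) \<longleftrightarrow>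
      (?F V, ?F V') \<in> relation_of (\<subseteq>) (boolean_completion P R)"
    if "V \<in> boolean_completion Q S" "V' \<in> boolean_completion Q S" for V V'
    using that F reflect[OF that] unfolding relation_of_def by blast
  ultimately have "order_isomorphic
      (boolean_completion Q S) (relation_of (\<subseteq>) (boolean_completion Q S))
      (boolean_completion P R) (relation_of (\<subseteq>) (boolean_completion P R))"
    unfolding order_isomorphic_def order_iso_def by blast
  \<comment> \<open>Preimage leads from the completion of \<open>Q\<close> to that of
    \<open>P\<close>, hence the reversal.\<close>
  then show ?thesis
    unfolding forcing_equivalent_def by (rule order_isomorphic_sym)
qed

section \<open>Families generating the positive sets of an ideal\<close>

text \<open>This isolates what the order theory needs from the copies. Indivisibility enters only
  through \<open>ideal_Un\<close>.\<close>

locale positive_base =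
  fixes U :: "'a set" and C :: "'a set set" and J :: "'a set set"
  assumes base_subset: "A \<in> C \<Longrightarrow> A \<subseteq> U"
    and empty_notin_base: "{} \<notin> C"
    and ideal_eq: "J = {I. I \<subseteq> U \<and> \<not> (\<exists>A\<in>C. A \<subseteq> I)}"
    and ideal_Un: "I \<in> J \<Longrightarrow> K \<in> J \<Longrightarrow> I \<union> K \<in> J"
begin

lemma empty_in_ideal: "{} \<in> J"
  using empty_notin_base unfolding ideal_eq by auto

lemma ideal_mono: "I \<in> J \<Longrightarrow> K \<subseteq> I \<Longrightarrow> K \<in> J"
  unfolding ideal_eq by blast

lemma base_positive: "A \<in> C \<Longrightarrow> A \<notin> J"
  unfolding ideal_eq by blast

lemma ex_base_subset: "B \<subseteq> U \<Longrightarrow> B \<notin> J \<Longrightarrow> \<exists>A\<in>C. A \<subseteq> B"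
  unfolding ideal_eq by blast

text \<open>\<open>A - D\<close> is covered by \<open>A - B\<close> and
  \<open>B - D\<close>.\<close>

lemma ideal_Diff_trans: "A - B \<in> J \<Longrightarrow> B - D \<in> J \<Longrightarrow> A - D \<in> J"
  by (rule ideal_mono[OF ideal_Un]) blast+

lemma sym_diff_in_ideal_iff: "sym_diff A B \<in> J \<longleftrightarrow> A - B \<in> J \<and> B - A \<in> J"
  using ideal_Un ideal_mono[of "sym_diff A B"] by blast

lemma separative_modification_base:
  "separative_modification C (relation_of (\<subseteq>) C) = relation_of (\<lambda>A B. A - B \<in> J) C"
proof -
  have iff: "(\<forall>R\<in>C. R \<subseteq> A \<longrightarrow> (\<exists>S\<in>C. S \<subseteq> R \<and> S \<subseteq> B)) \<longleftrightarrow> A - B \<in> J" if "A \<in> C" for A B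
  proof
    assume H: "\<forall>R\<in>C. R \<subseteq> A \<longrightarrow> (\<exists>S\<in>C. S \<subseteq> R \<and> S \<subseteq> B)"
    \<comment> \<open>Such an \<open>R\<close> would contain a member of \<open>C\<close> that also
      lies inside \<open>B\<close>, hence the empty set.\<close>
    have "\<not> R \<subseteq> A - B" if "R \<in> C" for R
    proof
      assume R: "R \<subseteq> A - B"
      then have "R \<subseteq> A" by blast
      then obtain S where S: "S \<in> C" "S \<subseteq> R" "S \<subseteq> B" using H \<open>R \<in> C\<close> by metis
      then have "S = {}" using R by blast
      then show False using empty_notin_base S(1) by simp
    qed
    then show "A - B \<in> J" using base_subset[OF \<open>A \<in> C\<close>] unfolding ideal_eq by blast
  next
    assume small: "A - B \<in> J"
    show "\<forall>R\<in>C. R \<subseteq> A \<longrightarrow> (\<exists>S\<in>C. S \<subseteq> R \<and> S \<subseteq> B)"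
    proof (intro ballI impI)
      fix R assume R: "R \<in> C" "R \<subseteq> A"
      \<comment> \<open>Otherwise \<open>R\<close> would be covered by the small sets
        \<open>A - B\<close> and \<open>R \<inter> B\<close>. Being positive,
        \<open>R \<inter> B\<close> contains the member of \<open>C\<close> sought.\<close>
      have "R \<inter> B \<notin> J"
      proof
        assume "R \<inter> B \<in> J"
        then have "(A - B) \<union> (R \<inter> B) \<in> J" by (rule ideal_Un[OF small])
        moreover have "R \<subseteq> (A - B) \<union> (R \<inter> B)" using R(2) by blast
        ultimately have "R \<in> J" by (rule ideal_mono)
        then show False using base_positive R(1) by blast
      qed
      then show "\<exists>S\<in>C. S \<subseteq> R \<and> S \<subseteq> B"
        using ex_base_subset[of "R \<inter> B"] base_subset[OF R(1)] by blast
    qed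
  qed
  have "(A, B) \<in> separative_modification C (relation_of (\<subseteq>) C) \<longleftrightarrow>
      A \<in> C \<and> B \<in> C \<and> (\<forall>R\<in>C. R \<subseteq> A \<longrightarrow> (\<exists>S\<in>C. S \<subseteq> R \<and> S \<subseteq> B))" for A B
    unfolding separative_modification_def relation_of_def by auto
  then show ?thesis
    using iff unfolding relation_of_def by auto
qed

lemma separative_modification_base_iff:
  "A \<in> C \<Longrightarrow> B \<in> C \<Longrightarrow>
    (A, B) \<in> separative_modification C (relation_of (\<subseteq>) C) \<longleftrightarrow> A - B \<in> J"
  unfolding separative_modification_base by (simp add: relation_of_def)

section \<open>The power set modulo the ideal and its positive part\<close>

lemma equiv_mod_equiv: "equiv (Pow U) (mod_equiv U J)"
proof (rule equivI)
  show "refl_on (Pow U) (mod_equiv U J)"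
    using empty_in_ideal unfolding refl_on_def mod_equiv_def by auto
  show "sym (mod_equiv U J)"
    unfolding sym_def mod_equiv_def by (auto simp: Un_commute)
  show "trans (mod_equiv U J)"
    unfolding trans_def mod_equiv_def sym_diff_in_ideal_iff using ideal_Diff_trans by blast
qed (auto simp: mod_equiv_def)

lemma mod_class_eq_iff:
  assumes "A \<subseteq> U" "B \<subseteq> U"
  shows "mod_equiv U J `` {A} = mod_equiv U J `` {B} \<longleftrightarrow> A - B \<in> J \<and> B - A \<in> J"
proof -
  have "(A, B) \<in> mod_equiv U J \<longleftrightarrow> A - B \<in> J \<and> B - A \<in> J"
    using assms sym_diff_in_ideal_iff[of A B] unfolding mod_equiv_def by blast
  then show ?thesis
    using eq_equiv_class_iff[OF equiv_mod_equiv, of A B] assms by blast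
qed

text \<open>The order is defined through some pair of representatives; this makes it independent of
  them, by chaining the small differences \<open>A - A'\<close>, \<open>A' - B'\<close> and
  \<open>B' - B\<close>.\<close>

lemma quot_pos_le_iff:
  assumes "A \<subseteq> U" "A \<notin> J" "B \<subseteq> U" "B \<notin> J"
  shows "(mod_equiv U J `` {A}, mod_equiv U J `` {B}) \<in> quot_pos_le U J \<longleftrightarrow> A - B \<in> J"
proof
  assume "(mod_equiv U J `` {A}, mod_equiv U J `` {B}) \<in> quot_pos_le U J"
  then obtain A' B' where
    "mod_equiv U J `` {A} = mod_equiv U J `` {A'}" "mod_equiv U J `` {B} = mod_equiv U J `` {B'}"
    and "A' \<subseteq> U" "B' \<subseteq> U" and *: "A' - B' \<in> J"
    unfolding quot_pos_le_def by blast
  then have "A - A' \<in> J" "B' - B \<in> J"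
    using assms mod_class_eq_iff[of A A'] mod_class_eq_iff[of B B'] by simp_all
  then show "A - B \<in> J" using * by (meson ideal_Diff_trans)
next
  assume "A - B \<in> J"
  then show "(mod_equiv U J `` {A}, mod_equiv U J `` {B}) \<in> quot_pos_le U J"
    unfolding quot_pos_le_def using assms by blast
qed

lemma refl_on_quot_pos_le: "refl_on (quot_pos_carrier U J) (quot_pos_le U J)"
proof (rule refl_onI)
  fix x assume "x \<in> quot_pos_carrier U J"
  then obtain A where "x = mod_equiv U J `` {A}" "A \<subseteq> U" "A \<notin> J"
    unfolding quot_pos_carrier_def by blast
  then show "(x, x) \<in> quot_pos_le U J"
    using quot_pos_le_iff[of A A] empty_in_ideal by simp
qed

lemma trans_quot_pos_le: "trans (quot_pos_le U J)"
proof (rule transI)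
  fix x y z assume xy: "(x, y) \<in> quot_pos_le U J" and yz: "(y, z) \<in> quot_pos_le U J"
  obtain A B where A: "x = mod_equiv U J `` {A}" "A \<subseteq> U" "A \<notin> J"
    and B: "y = mod_equiv U J `` {B}" "B \<subseteq> U" "B \<notin> J" and "A - B \<in> J"
    using xy unfolding quot_pos_le_def by blast
  moreover obtain D where D: "z = mod_equiv U J `` {D}" "D \<subseteq> U" "D \<notin> J"
    using yz unfolding quot_pos_le_def by blast
  moreover have "B - D \<in> J"
    using yz quot_pos_le_iff[of B D] B D by blast
  ultimately show "(x, z) \<in> quot_pos_le U J"
    using ideal_Diff_trans quot_pos_le_iff[of A D] by blast
qed

lemma quot_pos_le_base_iff:
  assumes "A \<in> C" "B \<in> C"
  shows "(mod_equiv U J `` {A}, mod_equiv U J `` {B}) \<in> quot_pos_le U J \<longleftrightarrow> A - B \<in> J"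
  using quot_pos_le_iff[of A B] assms base_subset base_positive by blast

lemma dense_subset_base:
  "dense_subset (quot_pos_carrier U J) (quot_pos_le U J) ((\<lambda>A. mod_equiv U J `` {A}) ` C)"
  unfolding dense_subset_def
proof
  show "(\<lambda>A. mod_equiv U J `` {A}) ` C \<subseteq> quot_pos_carrier U J"
    using base_subset base_positive unfolding quot_pos_carrier_def by blast
  show "\<forall>q\<in>quot_pos_carrier U J. \<exists>d\<in>(\<lambda>A. mod_equiv U J `` {A}) ` C. (d, q) \<in> quot_pos_le U J"
  proof
    fix q assume "q \<in> quot_pos_carrier U J"
    then obtain B where B: "q = mod_equiv U J `` {B}" "B \<subseteq> U" "B \<notin> J"
      unfolding quot_pos_carrier_def by blast
    then obtain A where A: "A \<in> C" "A \<subseteq> B" using ex_base_subset by blast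
    then have "A - B \<in> J" using empty_in_ideal by (simp add: Diff_eq_empty_iff[THEN iffD2])
    then have "(mod_equiv U J `` {A}, q) \<in> quot_pos_le U J"
      using quot_pos_le_iff[of A B] A B base_positive by blast
    then show "\<exists>d\<in>(\<lambda>A. mod_equiv U J `` {A}) ` C. (d, q) \<in> quot_pos_le U J"
      using A by blast
  qed
qed

section \<open>The separative quotient and the forcing equivalence\<close>

lemma separative_equiv_base:
  "separative_equiv C (relation_of (\<subseteq>) C) = mod_equiv U J \<inter> C \<times> C"
proof -
  have "(A, B) \<in> separative_equiv C (relation_of (\<subseteq>) C) \<longleftrightarrow> (A, B) \<in> mod_equiv U J \<inter> C \<times> C"
    for A B
    using base_subset[of A] base_subset[of B] sym_diff_in_ideal_iff[of A B]
    unfolding separative_equiv_def separative_modification_base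
    by (auto simp: relation_of_def mod_equiv_def)
  then show ?thesis by (intro set_eqI) auto
qed

text \<open>Separative classes are the traces on \<open>C\<close> of classes modulo the ideal. The
  isomorphism saturates a trace under \<open>mod_equiv U J\<close>, which recovers the whole class
  without choosing a representative.\<close>

lemma order_isomorphic_sq_base:
  fixes D
  defines "D \<equiv> (\<lambda>A. mod_equiv U J `` {A}) ` C"
  shows "order_isomorphic (sq_carrier C (relation_of (\<subseteq>) C)) (sq_le C (relation_of (\<subseteq>) C))
    D (quot_pos_le U J \<inter> D \<times> D)"
proof -
  let ?E = "separative_equiv C (relation_of (\<subseteq>) C)"
  let ?M = "mod_equiv U J"
  have cls: "?M `` (?E `` {A}) = ?M `` {A}" if "A \<in> C" for A
  proof -
    have "A \<in> ?E `` {A}"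
      using that base_subset empty_in_ideal unfolding separative_equiv_base
      by (auto simp: mod_equiv_def)
    then show ?thesis
      using equivE[OF equiv_mod_equiv] unfolding separative_equiv_base by (blast dest: transD)
  qed
  have E_eq: "?E `` {A} = ?E `` {B} \<longleftrightarrow> ?M `` {A} = ?M `` {B}" if "A \<in> C" "B \<in> C" for A B
  proof
    assume "?M `` {A} = ?M `` {B}"
    then show "?E `` {A} = ?E `` {B}"
      using that unfolding separative_equiv_base by blast
  qed (metis cls that)
  have carrier: "sq_carrier C (relation_of (\<subseteq>) C) = (\<lambda>A. ?E `` {A}) ` C"
    unfolding sq_carrier_def quotient_def by blast
  have sq_le: "(?E `` {A}, ?E `` {B}) \<in> sq_le C (relation_of (\<subseteq>) C) \<longleftrightarrow>
      (?M `` {A}, ?M `` {B}) \<in> quot_pos_le U J" if "A \<in> C" "B \<in> C" for A B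
  proof -
    have "(?E `` {A}, ?E `` {B}) \<in> sq_le C (relation_of (\<subseteq>) C) \<longleftrightarrow>
        (\<exists>A'\<in>C. \<exists>B'\<in>C. ?E `` {A} = ?E `` {A'} \<and> ?E `` {B} = ?E `` {B'} \<and> A' - B' \<in> J)"
      unfolding sq_le_def separative_modification_base by (auto simp: relation_of_def)
    also have "\<dots> \<longleftrightarrow> (?M `` {A}, ?M `` {B}) \<in> quot_pos_le U J"
      \<comment> \<open>By \<open>E_eq\<close>, the representatives \<open>A'\<close> and
        \<open>B'\<close> name the same classes modulo the ideal as \<open>A\<close> and
        \<open>B\<close>.\<close>
      using that E_eq quot_pos_le_base_iff by metis
    finally show ?thesis .
  qed
  have "bij_betw (\<lambda>S. ?M `` S) (sq_carrier C (relation_of (\<subseteq>) C)) D"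
    unfolding bij_betw_def carrier D_def image_image
    using cls E_eq by (auto simp: inj_on_def)
  moreover have "(x, y) \<in> sq_le C (relation_of (\<subseteq>) C) \<longleftrightarrow>
      (?M `` x, ?M `` y) \<in> quot_pos_le U J \<inter> D \<times> D"
    if "x \<in> sq_carrier C (relation_of (\<subseteq>) C)" "y \<in> sq_carrier C (relation_of (\<subseteq>) C)" for x y
    using that sq_le cls unfolding carrier D_def by auto
  ultimately show ?thesis
    unfolding order_isomorphic_def order_iso_def by blast
qed

lemma forcing_equivalent_base:
  "forcing_equivalent C (relation_of (\<subseteq>) C) (quot_pos_carrier U J) (quot_pos_le U J)"
proof (rule forcing_equivalent_dense_map[where e = "\<lambda>A. mod_equiv U J `` {A}"])
  show "refl_on C (relation_of (\<subseteq>) C)"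
    unfolding refl_on_def relation_of_def by blast
  show "trans (relation_of (\<subseteq>) C)"
    unfolding trans_def relation_of_def by blast
  show "(\<lambda>A. mod_equiv U J `` {A}) ` C \<subseteq> quot_pos_carrier U J"
    using dense_subset_base unfolding dense_subset_def by blast
  show "(mod_equiv U J `` {A}, mod_equiv U J `` {B}) \<in> quot_pos_le U J \<longleftrightarrow>
      (A, B) \<in> separative_modification C (relation_of (\<subseteq>) C)" if "A \<in> C" "B \<in> C" for A B
    \<comment> \<open>Both sides say \<open>A - B \<in> J\<close>.\<close>
    using that by (simp only: quot_pos_le_base_iff separative_modification_base_iff)
  show "refl_on (quot_pos_carrier U J) (quot_pos_le U J)" by (rule refl_on_quot_pos_le)
  show "trans (quot_pos_le U J)" by (rule trans_quot_pos_le)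
  show "dense_subset (quot_pos_carrier U J) (quot_pos_le U J) ((\<lambda>A. mod_equiv U J `` {A}) ` C)"
    by (rule dense_subset_base)
qed

end

section \<open>Copies of an indivisible structure\<close>

lemma map_in_tuples: "xs \<in> tuples U n \<Longrightarrow> f ` U \<subseteq> V \<Longrightarrow> map f xs \<in> tuples V n"
  unfolding tuples_def by auto

lemma embedding_comp:
  assumes f: "embedding X Y f" and g: "embedding Y Z g"
  shows "embedding X Z (g \<circ> f)"
proof -
  have fX: "f ` univ X \<subseteq> univ Y" using f unfolding embedding_def by blast
  have "inj_on (g \<circ> f) (univ X)"
    using f g inj_on_subset[OF _ fX, of g] unfolding embedding_def
    by (intro comp_inj_on) simp_all
  moreover have "xs \<in> rels X i \<longleftrightarrow> map (g \<circ> f) xs \<in> rels Z i"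
    if "i \<in> idx X" "xs \<in> tuples (univ X) (arity X i)" for i xs
  proof -
    have "xs \<in> rels X i \<longleftrightarrow> map f xs \<in> rels Y i"
      using f that unfolding embedding_def by blast
    also have "\<dots> \<longleftrightarrow> map g (map f xs) \<in> rels Z i"
      using f g that map_in_tuples[OF that(2) fX] unfolding embedding_def by metis
    finally show ?thesis by simp
  qed
  ultimately show ?thesis
    using f g unfolding embedding_def by (simp add: image_subset_iff)
qed

text \<open>Restricting the relations to tuples over \<open>A\<close> changes nothing for tuples
  \<open>map f xs\<close>, which already lie over \<open>A\<close>. The conjunct
  \<open>A \<subseteq> univ Y\<close> is what carries the range of \<open>f\<close> from
  \<open>A\<close> into \<open>univ Y\<close>.\<close>

lemma embedding_substructure_iff:
  "embedding X (substructure Y A) f \<and> A \<subseteq> univ Y \<longleftrightarrow>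
    embedding X Y f \<and> f ` univ X \<subseteq> A \<and> A \<subseteq> univ Y"
proof -
  have "map f xs \<in> tuples A n" if "xs \<in> tuples (univ X) n" "f ` univ X \<subseteq> A" for xs n
    using that by (rule map_in_tuples)
  then show ?thesis
    unfolding embedding_def substructure_def by auto
qed

lemma isomorphic_structures_sym:
  assumes "isomorphic_structures X Y"
  shows "isomorphic_structures Y X"
proof -
  obtain f where f: "embedding X Y f" and im: "f ` univ X = univ Y"
    using assms unfolding isomorphic_structures_def by blast
  let ?g = "inv_into (univ X) f"
  have bij: "bij_betw f (univ X) (univ Y)"
    using f im unfolding embedding_def bij_betw_def by blast
  have g: "bij_betw ?g (univ Y) (univ X)"
    using bij by (rule bij_betw_inv_into)
  have "ys \<in> rels Y i \<longleftrightarrow> map ?g ys \<in> rels X i"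
    if i: "i \<in> idx Y" and ys: "ys \<in> tuples (univ Y) (arity Y i)" for i ys
  proof -
    have "map f (map ?g ys) = ys"
      using ys bij_betw_inv_into_right[OF bij] unfolding tuples_def
      by (auto intro!: map_idI)
    moreover have "map ?g ys \<in> tuples (univ X) (arity X i)"
      using map_in_tuples[OF ys, of ?g "univ X"] f i bij_betw_imp_surj_on[OF g]
      unfolding embedding_def by auto
    ultimately show ?thesis
      using f i unfolding embedding_def by metis
  qed
  then have "embedding Y X ?g"
    using f bij_betw_imp_surj_on[OF g] bij_betw_imp_inj_on[OF g] unfolding embedding_def by auto
  then show ?thesis
    using bij_betw_imp_surj_on[OF g] unfolding isomorphic_structures_def by blast
qed

text \<open>Inverting an isomorphism from the substructure on \<open>A\<close> to \<open>X\<close>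
  gives a self-embedding with range \<open>A\<close>. In this form, new copies arise by composing
  embeddings.\<close>

lemma copies_eq: "copies X = {f ` univ X | f. embedding X X f}"
proof -
  have "isomorphic_structures (substructure X A) X \<longleftrightarrow> (\<exists>f. embedding X X f \<and> f ` univ X = A)"
    if A: "A \<subseteq> univ X" for A
  proof -
    have "isomorphic_structures (substructure X A) X \<longleftrightarrow>
        isomorphic_structures X (substructure X A)"
      using isomorphic_structures_sym by blast
    also have "\<dots> \<longleftrightarrow> (\<exists>f. embedding X X f \<and> f ` univ X = A)"
      using A embedding_substructure_iff[of X X A] unfolding isomorphic_structures_def
      by (auto simp: substructure_def)
    finally show ?thesis .
  qed
  moreover have "f ` univ X \<subseteq> univ X" if "embedding X X f" for f
    using that unfolding embedding_def by blast
  ultimately have "A \<in> copies X \<longleftrightarrow> (\<exists>f. embedding X X f \<and> f ` univ X = A)" for A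
    unfolding copies_def by auto
  then show ?thesis
    by (intro set_eqI) (simp add: eq_commute conj_commute)
qed

text \<open>Pull the cover back along an embedding \<open>f\<close> onto \<open>A\<close>, split
  \<open>X\<close> by indivisibility, and push the resulting embedding \<open>g\<close> forward to
  \<open>f \<circ> g\<close>.\<close>

lemma indivisible_copy_cover:
  assumes X: "indivisible X" and A: "A \<in> copies X" and cover: "A \<subseteq> I \<union> K"
  shows "\<exists>B\<in>copies X. B \<subseteq> I \<or> B \<subseteq> K"
proof -
  obtain f where f: "embedding X X f" "f ` univ X = A"
    using A unfolding copies_eq by blast
  \<comment> \<open>\<open>?K\<close> is the complement of \<open>?I\<close>, as indivisibility asks
    for disjoint pieces; \<open>cover\<close> ensures that \<open>f\<close> maps it into
    \<open>K\<close>.\<close>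
  let ?I = "{x \<in> univ X. f x \<in> I}" and ?K = "{x \<in> univ X. f x \<notin> I}"
  have "univ X = ?I \<union> ?K \<and> ?I \<inter> ?K = {}"
    by blast
  then have "embeds X (substructure X ?I) \<or> embeds X (substructure X ?K)"
    using X unfolding indivisible_def by blast
  moreover have "\<exists>g. embedding X X g \<and> g ` univ X \<subseteq> M"
    if "embeds X (substructure X M)" "M \<subseteq> univ X" for M
    using that embedding_substructure_iff[of X X M] unfolding embeds_def by auto
  ultimately obtain g where g: "embedding X X g" "g ` univ X \<subseteq> ?I \<or> g ` univ X \<subseteq> ?K"
    by (metis (no_types, lifting) mem_Collect_eq subsetI)
  have "(f \<circ> g) ` univ X \<in> copies X"
    using embedding_comp[OF g(1) f(1)] unfolding copies_eq by blast
  moreover have "(f \<circ> g) ` univ X \<subseteq> I \<or> (f \<circ> g) ` univ X \<subseteq> K"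
    using g(2) f(2) cover by auto
  ultimately show ?thesis by blast
qed

lemma positive_base_copies:
  assumes "univ X \<noteq> {}" "indivisible X"
  shows "positive_base (univ X) (copies X) (copy_ideal X)"
proof
  show "{} \<notin> copies X"
    using assms(1) unfolding copies_eq by auto
  show "I \<union> K \<in> copy_ideal X" if "I \<in> copy_ideal X" "K \<in> copy_ideal X" for I K
    using that indivisible_copy_cover[OF assms(2), of _ I K] unfolding copy_ideal_def by auto
qed (auto simp: copies_def copy_ideal_def)

theorem theorem5p2:
  fixes X :: "('a, 'i) rel_struct"
  assumes "relational_structure X"
    and "indivisible X"
  shows "separative_modification (copies X) (relation_of (\<subseteq>) (copies X)) =
      relation_of (\<lambda>A B. A - B \<in> copy_ideal X) (copies X) \<and>
    (\<exists>D. dense_subset (quot_pos_carrier (univ X) (copy_ideal X))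
            (quot_pos_le (univ X) (copy_ideal X)) D \<and>
          order_isomorphic
            (sq_carrier (copies X) (relation_of (\<subseteq>) (copies X)))
            (sq_le (copies X) (relation_of (\<subseteq>) (copies X)))
            D (quot_pos_le (univ X) (copy_ideal X) \<inter> D \<times> D)) \<and>
    forcing_equivalent
      (copies X) (relation_of (\<subseteq>) (copies X))
      (quot_pos_carrier (univ X) (copy_ideal X)) (quot_pos_le (univ X) (copy_ideal X))"
proof -
  interpret positive_base "univ X" "copies X" "copy_ideal X"
    using assms unfolding relational_structure_def by (intro positive_base_copies) blast+
  \<comment> \<open>The witness \<open>D\<close> is the set of classes of copies modulo
    \<open>copy_ideal X\<close>.\<close>
  show ?thesis
    using separative_modification_base dense_subset_base order_isomorphic_sq_base
      forcing_equivalent_base by blast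
qed

end
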